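(* Let $\mathfrak{l}=\mathfrak{sl}_2(\mathbf{C})\ltimes\mathfrak{sl}_2(\mathbf{C})^*$ be the 6-dimensional complex Lie algebra with basis $(e_1,e_0,e_{-1},E_1,E_0,E_{-1})$ described in the context, and let $\mathbf{C}[t]$ be the polynomial ring. View $\mathfrak{l}\otimes_{\mathbf{C}}\mathbf{C}[t]$ as a Lie algebra over $\mathbf{C}$. Then $H_2(\mathfrak{l}\otimes\mathbf{C}[t])\neq\{0\}$; namely, $te_1\wedge E_{-1}-e_1\wedge tE_{-1}$ is a 2-cycle that represents a nonzero element in $H_2(\mathfrak{l}\otimes\mathbf{C}[t])$.
   Context: $\mathfrak{l}$ is the semidirect product of $\mathfrak{sl}_2$ with its coadjoint representation (the dual being an abelian ideal). Here $(e_1,e_0,e_{-1})$ is a basis of $\mathfrak{sl}_2$, $(E_{-1},E_0,E_1)$ is the dual basis ($E_{-i}(e_i)=1$), and the nonzero brackets are, for $\epsilon\in\{1,-1\}$: $[e_0,e_\epsilon]=\epsilon e_\epsilon$, $[e_1,e_{-1}]=e_0$, $[e_0,E_\epsilon]=\epsilon E_\epsilon$, $[e_\epsilon,E_0]=-\epsilon E_\epsilon$, $[e_\epsilon,E_{-\epsilon}]=\epsilon E_0$ (and those deduced by antisymmetry). The bracket on $\mathfrak{l}\otimes\mathbf{C}[t]$ is the $\mathbf{C}[t]$-bilinear extension, and $tx$ stands for $x\otimes t$, $x$ for $x\otimes 1$. $H_2$ denotes Chevalley–Eilenberg homology over $\mathbf{C}$ with trivial coefficients (exterior powers over $\mathbf{C}$).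 *)

theory Defs
  imports
    "HOL-Analysis.Cartesian_Space"
    "HOL-Library.Poly_Mapping"
    "HOL-Computational_Algebra.Polynomial"
    "HOL-Algebra.Coset"
begin

section \<open>Exterior powers\<close>

text \<open>
  A chain is a formal linear combination of lists of vectors; the lists of length \<open>n\<close> stand for
  formal \<open>n\<close>-tuples.
\<close>

definition chain_scale :: "'k::field \<Rightarrow> ('v list \<Rightarrow>\<^sub>0 'k) \<Rightarrow> ('v list \<Rightarrow>\<^sub>0 'k)" where
  "chain_scale c u = Poly_Mapping.map ((*) c) u"

lemma lookup_chain_scale [simp]:
  "Poly_Mapping.lookup (chain_scale c u) xs = c * Poly_Mapping.lookup u xs"
  unfolding chain_scale_def by (simp add: Poly_Mapping.map.rep_eq when_def)

global_interpretation chain: vector_space chain_scale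
  by unfold_locales (auto intro!: poly_mapping_eqI simp: lookup_add algebra_simps)

definition list_chains :: "nat \<Rightarrow> ('v list \<Rightarrow>\<^sub>0 'k::field) monoid" where
  "list_chains n =
    \<lparr>carrier = {u. Poly_Mapping.keys u \<subseteq> {xs. length xs = n}}, mult = (+), one = 0\<rparr>"

lemma list_chains_simps [simp]:
  "u \<in> carrier (list_chains n) \<longleftrightarrow> (\<forall>xs. length xs \<noteq> n \<longrightarrow> Poly_Mapping.lookup u xs = 0)"
  "mult (list_chains n) = (+)" "one (list_chains n) = 0"
  by (auto simp: list_chains_def in_keys_iff)

lemma comm_group_list_chains: "comm_group (list_chains n)"
proof (rule comm_groupI)
  fix u :: "'a list \<Rightarrow>\<^sub>0 'b" assume "u \<in> carrier (list_chains n)"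
  then show "\<exists>v\<in>carrier (list_chains n). v \<otimes>\<^bsub>list_chains n\<^esub> u = \<one>\<^bsub>list_chains n\<^esub>"
    by (intro bexI[of _ "- u"]) auto
qed (auto simp: lookup_add algebra_simps)

locale exterior = vector_space scale
  for scale :: "'a::field \<Rightarrow> 'b::ab_group_add \<Rightarrow> 'b"
begin

text \<open>
  The \<open>n\<close>-th exterior power over the ground field: the free vector space on \<open>n\<close>-tuples modulo
  multilinearity (in each argument) and the alternating law.
\<close>

definition ext_relations :: "nat \<Rightarrow> ('b list \<Rightarrow>\<^sub>0 'a) set" where
  "ext_relations n = chain.span
    ({Poly_Mapping.single (xs[i := scale a x + y]) 1
        - chain_scale a (Poly_Mapping.single (xs[i := x]) 1)
        - Poly_Mapping.single (xs[i := y]) 1 | xs i a x y. length xs = n \<and> i < n}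
     \<union> {Poly_Mapping.single xs 1 | xs i j. length xs = n \<and> i < j \<and> j < n \<and> xs ! i = xs ! j})"

definition ext_power :: "nat \<Rightarrow> ('b list \<Rightarrow>\<^sub>0 'a) set monoid" where
  "ext_power n = list_chains n Mod ext_relations n"

definition wedge :: "'b list \<Rightarrow> ('b list \<Rightarrow>\<^sub>0 'a) set" where
  "wedge xs = ext_relations (length xs) #>\<^bsub>list_chains (length xs)\<^esub> Poly_Mapping.single xs 1"

lemma ext_relations_normal: "ext_relations n \<lhd> list_chains n"
proof -
  interpret G: comm_group "list_chains n :: ('b list \<Rightarrow>\<^sub>0 'a) monoid"
    by (rule comm_group_list_chains)
  have sub: "chain.subspace (carrier (list_chains n) :: ('b list \<Rightarrow>\<^sub>0 'a) set)"
    by (simp add: chain.subspace_def lookup_add)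
  have incl: "ext_relations n \<subseteq> carrier (list_chains n)"
    unfolding ext_relations_def
    by (rule chain.span_minimal[OF _ sub]) (auto simp: lookup_minus lookup_single when_def)
  have "subgroup (ext_relations n) (list_chains n)"
  proof (rule G.subgroupI)
    fix u assume u: "u \<in> ext_relations n"
    have inv: "inv\<^bsub>list_chains n\<^esub> u = - u"
      by (rule G.inv_equality) (use u incl in \<open>auto simp del: list_chains_simps(1)
        simp: chain.subspace_neg[OF sub] subset_iff\<close>)
    show "inv\<^bsub>list_chains n\<^esub> u \<in> ext_relations n"
      using u unfolding inv ext_relations_def by (rule chain.span_neg)
  next
    fix u v assume "u \<in> ext_relations n" "v \<in> ext_relations n"
    then show "u \<otimes>\<^bsub>list_chains n\<^esub> v \<in> ext_relations n"
      unfolding ext_relations_def by (simp add: chain.span_add)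
  next
    show "ext_relations n \<noteq> {}"
      unfolding ext_relations_def using chain.span_zero by blast
  qed (rule incl)
  then show ?thesis by (rule G.subgroup_imp_normal)
qed

lemma comm_group_ext_power: "comm_group (ext_power n)"
  unfolding ext_power_def
  using comm_group.abelian_FactGroup[OF comm_group_list_chains]
    ext_relations_normal normal_imp_subgroup by blast

end


section \<open>Chevalley--Eilenberg homology with trivial coefficients\<close>

locale lie_algebra = exterior scale
  for scale :: "'k::field \<Rightarrow> 'v::ab_group_add \<Rightarrow> 'v" +
  fixes br :: "'v \<Rightarrow> 'v \<Rightarrow> 'v"
  assumes br_add_left: "br (x + y) z = br x z + br y z"
    and br_add_right: "br x (y + z) = br x y + br x z"
    and br_scale_left: "br (scale c x) y = scale c (br x y)"
    and br_scale_right: "br x (scale c y) = scale c (br x y)"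
    and br_self: "br x x = 0"
    and jacobi: "br x (br y z) + br y (br z x) + br z (br x y) = 0"
begin

text \<open>
  \<open>d (x\<^sub>1 \<and> \<dots> \<and> x\<^sub>n) = \<Sum>\<^sub>i\<^sub><\<^sub>j (-1)\<^sup>i\<^sup>+\<^sup>j [x\<^sub>i, x\<^sub>j] \<and> x\<^sub>1 \<and> \<dots> \<and> x\<^sub>n\<close> with \<open>x\<^sub>i\<close> and \<open>x\<^sub>j\<close> omitted on the right.
  Positions in a list start at 0, which leaves the parity of \<open>i + j\<close> unchanged.
\<close>

definition ce_tuple :: "'v list \<Rightarrow> ('v list \<Rightarrow>\<^sub>0 'k)" where
  "ce_tuple xs = (\<Sum>(i, j) \<in> {(i, j). i < j \<and> j < length xs}.
     Poly_Mapping.single (br (xs ! i) (xs ! j) # nths xs (- {i, j})) ((- 1) ^ (i + j)))"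

definition ce_chain :: "('v list \<Rightarrow>\<^sub>0 'k) \<Rightarrow> ('v list \<Rightarrow>\<^sub>0 'k)" where
  "ce_chain u =
    (\<Sum>xs\<in>Poly_Mapping.keys u. chain_scale (Poly_Mapping.lookup u xs) (ce_tuple xs))"

text \<open>
  The map induced by \<^const>\<open>ce_chain\<close> from the \<open>n\<close>-th to the \<open>(n - 1)\<close>-st exterior power. The
  cosets in the union coincide, since \<^const>\<open>ce_chain\<close> maps relations to relations.
  For \<open>n = 0\<close> the truncated subtraction is harmless: the map is zero, as it is for \<open>n = 1\<close>.
\<close>

definition ce_boundary :: "nat \<Rightarrow> ('v list \<Rightarrow>\<^sub>0 'k) set \<Rightarrow> ('v list \<Rightarrow>\<^sub>0 'k) set" where
  "ce_boundary n A = (\<Union>u\<in>A. ext_relations (n - 1) #>\<^bsub>list_chains (n - 1)\<^esub> ce_chain u)"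

definition ce_cycles :: "nat \<Rightarrow> ('v list \<Rightarrow>\<^sub>0 'k) set set" where
  "ce_cycles n = kernel (ext_power n) (ext_power (n - 1)) (ce_boundary n)"

definition ce_boundaries :: "nat \<Rightarrow> ('v list \<Rightarrow>\<^sub>0 'k) set set" where
  "ce_boundaries n = ce_boundary (Suc n) ` carrier (ext_power (Suc n))"

text \<open>
  Homology is recorded by its underlying abelian group, which is all that vanishing depends on;
  the ground field enters through the exterior powers.
\<close>

definition ce_homology :: "nat \<Rightarrow> ('v list \<Rightarrow>\<^sub>0 'k) set set monoid" where
  "ce_homology n = (ext_power n\<lparr>carrier := ce_cycles n\<rparr>) Mod ce_boundaries n"

definition homology_class ::
    "nat \<Rightarrow> ('v list \<Rightarrow>\<^sub>0 'k) set \<Rightarrow> ('v list \<Rightarrow>\<^sub>0 'k) set set" where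
  "homology_class n z = ce_boundaries n #>\<^bsub>ext_power n\<lparr>carrier := ce_cycles n\<rparr>\<^esub> z"

end


section \<open>The Lie algebra and its extension of scalars to polynomials\<close>

text \<open>
  \<open>e1\<close>, \<open>e0\<close>, \<open>em1\<close> index the basis \<open>(e\<^sub>1, e\<^sub>0, e\<^sub>-\<^sub>1)\<close> of \<open>\<ss>\<ll>\<^sub>2\<close>; \<open>E1\<close>, \<open>E0\<close>, \<open>Em1\<close> index the basis
  \<open>(E\<^sub>1, E\<^sub>0, E\<^sub>-\<^sub>1)\<close> of its dual, where \<open>E\<^sub>-\<^sub>i\<close> is dual to \<open>e\<^sub>i\<close>.
\<close>

datatype lidx = e1 | e0 | em1 | E1 | E0 | Em1

lemma UNIV_lidx: "(UNIV :: lidx set) = {e1, e0, em1, E1, E0, Em1}"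
  using lidx.exhaust by auto

instance lidx :: finite
  by standard (simp add: UNIV_lidx)

text \<open>
  Each bracket is listed in one order only; \<open>lbasis_bracket\<close> adds those deduced by antisymmetry.
  Over \<open>R\<close> the vectors \<open>R ^ lidx\<close> form the free module \<open>\<ll> \<otimes> R\<close>, and \<open>lbracket\<close> is the \<open>R\<close>-bilinear
  extension of the bracket of basis vectors.
\<close>

fun lbasis_table :: "lidx \<Rightarrow> lidx \<Rightarrow> 'r::comm_ring_1 ^ lidx" where
  "lbasis_table e0 e1 = axis e1 1"
| "lbasis_table e0 em1 = - axis em1 1"
| "lbasis_table e1 em1 = axis e0 1"
| "lbasis_table e0 E1 = axis E1 1"
| "lbasis_table e0 Em1 = - axis Em1 1"
| "lbasis_table e1 E0 = - axis E1 1"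
| "lbasis_table em1 E0 = axis Em1 1"
| "lbasis_table e1 Em1 = axis E0 1"
| "lbasis_table em1 E1 = - axis E0 1"
| "lbasis_table _ _ = 0"

definition lbasis_bracket :: "lidx \<Rightarrow> lidx \<Rightarrow> 'r::comm_ring_1 ^ lidx" where
  "lbasis_bracket i j = lbasis_table i j - lbasis_table j i"

definition lbracket :: "'r::comm_ring_1 ^ lidx \<Rightarrow> 'r ^ lidx \<Rightarrow> 'r ^ lidx" where
  "lbracket x y = (\<Sum>i\<in>UNIV. \<Sum>j\<in>UNIV. (x $ i * y $ j) *s lbasis_bracket i j)"

lemma lbracket_nth:
  fixes x y :: "'r::comm_ring_1 ^ lidx"
  shows
    "lbracket x y $ e1 = x $ e0 * y $ e1 - x $ e1 * y $ e0"
    "lbracket x y $ e0 = x $ e1 * y $ em1 - x $ em1 * y $ e1"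
    "lbracket x y $ em1 = x $ em1 * y $ e0 - x $ e0 * y $ em1"
    "lbracket x y $ E1 = x $ e0 * y $ E1 - x $ E1 * y $ e0 - x $ e1 * y $ E0 + x $ E0 * y $ e1"
    "lbracket x y $ E0 = x $ e1 * y $ Em1 - x $ Em1 * y $ e1 - x $ em1 * y $ E1 + x $ E1 * y $ em1"
    "lbracket x y $ Em1 = x $ Em1 * y $ e0 - x $ e0 * y $ Em1 + x $ em1 * y $ E0 - x $ E0 * y $ em1"
  by (simp_all add: lbracket_def UNIV_lidx lbasis_bracket_def axis_def)

lemma lvec_eqI:
  fixes x y :: "'r ^ lidx"
  assumes "x $ e1 = y $ e1" "x $ e0 = y $ e0" "x $ em1 = y $ em1"
    "x $ E1 = y $ E1" "x $ E0 = y $ E0" "x $ Em1 = y $ Em1"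
  shows "x = y"
  unfolding vec_eq_iff by (rule allI, rename_tac i, case_tac i) (simp_all add: assms)

lemma lbracket_laws:
  fixes x y z :: "'r::idom ^ lidx"
  shows "lbracket (x + y) z = lbracket x z + lbracket y z"
    and "lbracket x (y + z) = lbracket x y + lbracket x z"
    and "lbracket (c *s x) y = c *s lbracket x y"
    and "lbracket x (c *s y) = c *s lbracket x y"
    and "lbracket x x = 0"
    and "lbracket x (lbracket y z) + lbracket y (lbracket z x) + lbracket z (lbracket x y) = 0"
  by (rule lvec_eqI; simp only: lbracket_nth vector_add_component vector_smult_component zero_index;
      algebra)+

global_interpretation l: lie_algebra "(*s) :: complex \<Rightarrow> complex ^ lidx \<Rightarrow> complex ^ lidx" lbracket
  by unfold_locales
    (rule lbracket_laws vector_add_ldistrib vector_sadd_rdistrib vector_smult_assoc vector_smult_lid)+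

text \<open>The ideal spanned by the \<open>E\<^sub>i\<close> carries the coadjoint action: \<open>(x \<cdot> \<phi>)(y) = - \<phi>([x, y])\<close>.\<close>

lemma lbracket_coadjoint:
  fixes x y \<phi> :: "complex ^ lidx"
  defines "pair \<equiv> \<lambda>\<phi> y :: complex ^ lidx. \<phi> $ Em1 * y $ e1 + \<phi> $ E0 * y $ e0 + \<phi> $ E1 * y $ em1"
  assumes "\<phi> $ e1 = 0" "\<phi> $ e0 = 0" "\<phi> $ em1 = 0"
    and "x $ E1 = 0" "x $ E0 = 0" "x $ Em1 = 0"
  shows "pair (lbracket x \<phi>) y = - pair \<phi> (lbracket x y)"
  using assms by (simp add: lbracket_nth algebra_simps)

text \<open>The pure tensor \<open>x \<otimes> p\<close> in \<open>\<ll> \<otimes> \<complex>[t]\<close>, and the complex scalar multiplication.\<close>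

definition ltensor :: "complex ^ lidx \<Rightarrow> complex poly \<Rightarrow> complex poly ^ lidx" where
  "ltensor x p = (\<chi> i. smult (x $ i) p)"

definition lpoly_scale :: "complex \<Rightarrow> complex poly ^ lidx \<Rightarrow> complex poly ^ lidx" where
  "lpoly_scale c v = (\<chi> i. smult c (v $ i))"

lemma lbracket_ltensor:
  "lbracket (ltensor x p) (ltensor y q) = ltensor (lbracket x y) (p * q)"
  by (rule lvec_eqI)
     (simp_all add: ltensor_def lbracket_nth smult_diff_left smult_add_left algebra_simps)

global_interpretation lpoly: lie_algebra lpoly_scale lbracket
proof -
  have scale: "lpoly_scale c v = [:c:] *s v" for c v
    by (simp add: lpoly_scale_def vec_eq_iff)
  show "lie_algebra lpoly_scale lbracket"
  proof
    fix c d :: complex and x y z :: "complex poly ^ lidx"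
    show "lpoly_scale c (x + y) = lpoly_scale c x + lpoly_scale c y"
      and "lpoly_scale (c + d) x = lpoly_scale c x + lpoly_scale d x"
      and "lpoly_scale c (lpoly_scale d x) = lpoly_scale (c * d) x"
      and "lpoly_scale 1 x = x"
      by (simp_all add: lpoly_scale_def vec_eq_iff smult_add_left smult_add_right)
  qed (simp_all only: scale lbracket_laws)
qed

end

theory Submission
  imports Defs
begin

text \<open>
  A 2-cocycle of \<open>\<ll> \<otimes> \<complex>[t]\<close> with trivial coefficients detects the class. The cocycles that are
  homogeneous of degree \<open>1\<close> in \<open>t\<close> correspond to the derivations from \<open>\<ll>\<close> to its dual, and the dual
  is isomorphic to \<open>\<ll>\<close> by the invariant pairing of \<open>\<ss>\<ll>\<^sub>2\<close> with its dual. Up to sign, the outer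
  derivation that kills \<open>\<ss>\<ll>\<^sub>2\<close> and is the identity on the ideal gives the cocycle
  \<open>\<phi> (p e\<^sub>i) (q E\<^sub>-\<^sub>i) = p'(0) q(0)\<close>, which takes the value \<open>1\<close> on the given cycle.
\<close>

section \<open>Linear extension from tuples to chains\<close>

lemma (in vector_space) linear_poly_mapping_extension:
  fixes f :: "'x list \<Rightarrow> 'b"
  shows "Vector_Spaces.linear chain_scale scale
    (\<lambda>u. \<Sum>x\<in>Poly_Mapping.keys u. scale (Poly_Mapping.lookup u x) (f x))"
    (is "Vector_Spaces.linear _ _ ?F")
proof -
  \<comment> \<open>Cancellation can make the keys of \<open>u + v\<close> or of a multiple smaller
    than expected. Over any finite superset of the keys the extra terms vanish, so all sums can be
    compared on one index set.\<close>
  have superset: "?F u = (\<Sum>x\<in>A. scale (Poly_Mapping.lookup u x) (f x))"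
    if "finite A" "Poly_Mapping.keys u \<subseteq> A" for u A
    using that by (intro sum.mono_neutral_left) (auto simp: in_keys_iff)
  show ?thesis
  proof (unfold_locales, goal_cases)
    case (1 u v)
    let ?A = "Poly_Mapping.keys u \<union> Poly_Mapping.keys v"
    have "?F (u + v) = (\<Sum>x\<in>?A. scale (Poly_Mapping.lookup (u + v) x) (f x))"
      by (rule superset) (auto simp: in_keys_iff lookup_add)
    also have "\<dots> = (\<Sum>x\<in>?A. scale (Poly_Mapping.lookup u x) (f x))
        + (\<Sum>x\<in>?A. scale (Poly_Mapping.lookup v x) (f x))"
      by (simp add: lookup_add scale_left_distrib sum.distrib)
    also have "\<dots> = ?F u + ?F v"
      using superset[of ?A u] superset[of ?A v] by simp
    finally show ?case .
  next
    case (2 c u)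
    have "?F (chain_scale c u) = (\<Sum>x\<in>Poly_Mapping.keys u.
        scale (Poly_Mapping.lookup (chain_scale c u) x) (f x))"
      by (rule superset) (auto simp: in_keys_iff)
    also have "\<dots> = scale c (?F u)"
      by (simp add: scale_sum_right)
    finally show ?case .
  qed
qed

section \<open>Cosets and relations in exterior powers\<close>

context exterior
begin

lemma carrier_ext_powerI:
  "u \<in> carrier (list_chains n) \<Longrightarrow> ext_relations n #>\<^bsub>list_chains n\<^esub> u \<in> carrier (ext_power n)"
  unfolding ext_power_def FactGroup_def RCOSETS_def by auto

lemma mem_coset_iff:
  "v \<in> ext_relations n #>\<^bsub>list_chains n\<^esub> u \<longleftrightarrow> (\<exists>r\<in>ext_relations n. v = r + u)"
  unfolding r_coset_def by auto

lemma subspace_ext_relations: "chain.subspace (ext_relations n)"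
  unfolding ext_relations_def by (rule chain.subspace_span)

lemma zero_mem_ext_relations: "0 \<in> ext_relations n"
  by (rule chain.subspace_0[OF subspace_ext_relations])

text \<open>The projection to the quotient is a homomorphism. A difference of wedges thus gets a
  single chain as representative, on which the boundary and a cochain can be evaluated.\<close>

lemma wedge_diff:
  assumes "length xs = n" "length ys = n"
  shows "wedge xs \<otimes>\<^bsub>ext_power n\<^esub> inv\<^bsub>ext_power n\<^esub> wedge ys
    = ext_relations n #>\<^bsub>list_chains n\<^esub> (Poly_Mapping.single xs 1 - Poly_Mapping.single ys 1)"
proof -
  interpret G: comm_group "list_chains n :: ('b list \<Rightarrow>\<^sub>0 'a) monoid"
    by (rule comm_group_list_chains)
  interpret N: normal "ext_relations n" "list_chains n"
    by (rule ext_relations_normal)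
  let ?x = "Poly_Mapping.single xs (1 :: 'a)" and ?y = "Poly_Mapping.single ys (1 :: 'a)"
  have x: "?x \<in> carrier (list_chains n)" and y: "?y \<in> carrier (list_chains n)"
    and ny: "- ?y \<in> carrier (list_chains n)"
    using assms by (auto simp: lookup_single when_def)
  have inv: "inv\<^bsub>list_chains n\<^esub> ?y = - ?y"
    by (rule G.inv_equality) (use y ny in \<open>auto simp del: list_chains_simps(1)\<close>)
  have "inv\<^bsub>ext_power n\<^esub> wedge ys = ext_relations n #>\<^bsub>list_chains n\<^esub> (- ?y)"
    using carrier_ext_powerI[OF y] N.rcos_inv[OF y] assms(2)
    by (simp add: ext_power_def wedge_def N.inv_FactGroup inv del: list_chains_simps(1))
  then show ?thesis
    using N.rcos_sum[OF x ny] assms(1)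
    by (simp add: ext_power_def wedge_def del: list_chains_simps(1))
qed

text \<open>Minimality of the span: in length 2 the varied slot is the first or the second, and a
  repeated entry forces \<open>[x, x]\<close>. With \<open>S\<close> the kernel or a preimage of a
  subspace under a linear map, this reduces well-definedness on the exterior square to
  generators.\<close>

lemma ext_relations_2_subset:
  assumes "chain.subspace S"
    and "\<And>a x y w. Poly_Mapping.single [scale a x + y, w] 1
      - chain_scale a (Poly_Mapping.single [x, w] 1) - Poly_Mapping.single [y, w] 1 \<in> S"
    and "\<And>a x y w. Poly_Mapping.single [w, scale a x + y] 1
      - chain_scale a (Poly_Mapping.single [w, x] 1) - Poly_Mapping.single [w, y] 1 \<in> S"
    and "\<And>x. Poly_Mapping.single [x, x] 1 \<in> S"
  shows "ext_relations 2 \<subseteq> S"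
  unfolding ext_relations_def
proof (rule chain.span_minimal[OF _ assms(1)], rule Un_least; safe)
  fix xs :: "'b list" and i :: nat and a x y
  assume "length xs = 2" "i < 2"
  then obtain v w where "xs = [v, w]" "i = 0 \<or> i = 1"
    by (auto simp: numeral_2_eq_2 length_Suc_conv less_Suc_eq)
  then show "Poly_Mapping.single (xs[i := scale a x + y]) 1
      - chain_scale a (Poly_Mapping.single (xs[i := x]) 1)
      - Poly_Mapping.single (xs[i := y]) 1 \<in> S"
    using assms(2)[of a x y w] assms(3)[of v a x y] by auto
next
  fix xs :: "'b list" and i j :: nat
  assume "length xs = 2" "i < j" "j < 2" "xs ! i = xs ! j"
  then obtain v where "xs = [v, v]"
    by (auto simp: numeral_2_eq_2 length_Suc_conv less_Suc_eq)
  then show "Poly_Mapping.single xs 1 \<in> S"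
    using assms(4) by simp
qed

end

section \<open>The boundary map in degrees 2 and 3\<close>

context lie_algebra
begin

lemma br_skew: "br x y = - br y x"
  using br_self[of "x + y"]
  by (simp add: br_add_left br_add_right br_self[of x] br_self[of y] eq_neg_iff_add_eq_0 ac_simps)

lemma linear_ce_chain: "Vector_Spaces.linear chain_scale chain_scale ce_chain"
  unfolding ce_chain_def[abs_def] by (rule chain.linear_poly_mapping_extension)

sublocale ce_chain: Vector_Spaces.linear chain_scale chain_scale ce_chain
  by (rule linear_ce_chain)

lemma ce_chain_single: "ce_chain (Poly_Mapping.single xs 1) = ce_tuple xs"
  by (simp add: ce_chain_def)

lemma ce_tuple_2: "ce_tuple [x, y] = - Poly_Mapping.single [br x y] 1"
proof -
  have "{(i, j). i < j \<and> j < length [x, y]} = {(0, 1)}"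
    by auto
  then show ?thesis
    by (simp add: ce_tuple_def nths_Cons single_uminus)
qed

lemma ce_tuple_3:
  "ce_tuple [x, y, z] = Poly_Mapping.single [br x z, y] 1
    - Poly_Mapping.single [br x y, z] 1 - Poly_Mapping.single [br y z, x] 1"
proof -
  have "{(i, j). i < j \<and> j < length [x, y, z]} = {(0, 1), (0, 2), (1, 2)}"
    by auto
  then show ?thesis
    by (simp add: ce_tuple_def nths_Cons single_uminus)
qed

lemma single_linear_mem_ext_relations_1:
  "Poly_Mapping.single [scale a x + y] 1 - chain_scale a (Poly_Mapping.single [x] 1)
    - Poly_Mapping.single [y] 1 \<in> ext_relations 1"
  unfolding ext_relations_def
  \<comment> \<open>The witness \<open>[y]\<close> only supplies a list of length 1: the update at
    position 0 overwrites its entry.\<close>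
  by (rule chain.span_base, rule UnI1, rule CollectI, rule exI[of _ "[y]"], rule exI[of _ 0]) auto

text \<open>Bilinearity of \<open>br\<close> turns each linearity relation into the negative of one
  in degree 1, and \<open>br_self\<close> takes care of the alternating relations. Hence the
  boundary descends to the exterior square.\<close>

lemma ce_chain_ext_relations_2:
  assumes "u \<in> ext_relations 2"
  shows "ce_chain u \<in> ext_relations 1"
proof -
  have "ext_relations 2 \<subseteq> ce_chain -` ext_relations 1"
  proof (rule ext_relations_2_subset, goal_cases)
    case 1
    show ?case
      by (rule ce_chain.subspace_vimage) (rule subspace_ext_relations)
  next
    case (2 a x y w)
    have "ce_chain (Poly_Mapping.single [scale a x + y, w] 1
        - chain_scale a (Poly_Mapping.single [x, w] 1) - Poly_Mapping.single [y, w] 1)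
      = - (Poly_Mapping.single [scale a (br x w) + br y w] 1
        - chain_scale a (Poly_Mapping.single [br x w] 1) - Poly_Mapping.single [br y w] 1)"
      by (simp add: ce_chain.diff ce_chain.scale ce_chain_single ce_tuple_2
        br_add_left br_scale_left)
    then show ?case
      using chain.subspace_neg[OF subspace_ext_relations single_linear_mem_ext_relations_1]
      by (simp only: vimage_eq)
  next
    case (3 a x y w)
    have "ce_chain (Poly_Mapping.single [w, scale a x + y] 1
        - chain_scale a (Poly_Mapping.single [w, x] 1) - Poly_Mapping.single [w, y] 1)
      = - (Poly_Mapping.single [scale a (br w x) + br w y] 1
        - chain_scale a (Poly_Mapping.single [br w x] 1) - Poly_Mapping.single [br w y] 1)"
      by (simp add: ce_chain.diff ce_chain.scale ce_chain_single ce_tuple_2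
        br_add_right br_scale_right)
    then show ?case
      using chain.subspace_neg[OF subspace_ext_relations single_linear_mem_ext_relations_1]
      by (simp only: vimage_eq)
  next
    case (4 x)
    show ?case
      \<comment> \<open>This instance reads \<open>- Poly_Mapping.single [0] 1\<close>, which is
        exactly the boundary of \<open>[x, x]\<close>.\<close>
      using single_linear_mem_ext_relations_1[of 1 0 0]
      by (simp add: ce_chain_single ce_tuple_2 br_self)
  qed
  then show ?thesis
    using assms by blast
qed

text \<open>\<open>ce_boundary\<close> is a union over all representatives. These differ from
  \<open>u\<close> by relations, whose boundaries are again relations, so each contributes the zero
  coset \<open>ext_relations 1\<close>.\<close>

lemma coset_mem_ce_cycles_2:
  assumes "u \<in> carrier (list_chains 2)" "ce_chain u = 0"
  shows "ext_relations 2 #>\<^bsub>list_chains 2\<^esub> u \<in> ce_cycles 2"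
proof -
  let ?A = "ext_relations 2 #>\<^bsub>list_chains 2\<^esub> u"
  interpret R: subgroup "ext_relations 1" "list_chains 1"
    by (rule normal_imp_subgroup[OF ext_relations_normal])
  interpret G: comm_group "list_chains 1 :: ('v list \<Rightarrow>\<^sub>0 'k) monoid"
    by (rule comm_group_list_chains)
  have "ext_relations 1 #>\<^bsub>list_chains 1\<^esub> ce_chain v = ext_relations 1" if "v \<in> ?A" for v
  proof -
    have "ce_chain v \<in> ext_relations 1"
      using that assms(2) ce_chain_ext_relations_2 by (auto simp: mem_coset_iff ce_chain.add)
    then show ?thesis
      by (rule R.rcos_const[OF G.is_group])
  qed
  \<comment> \<open>The coset must be nonempty, as otherwise the union would be empty instead of the
    zero coset.\<close>
  moreover have "u \<in> ?A"
    using zero_mem_ext_relations by (force simp: mem_coset_iff)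
  ultimately have "ce_boundary 2 ?A = ext_relations 1"
    unfolding ce_boundary_def by auto
  then show ?thesis
    using carrier_ext_powerI[OF assms(1)]
    by (simp add: ce_cycles_def kernel_def ext_power_def[of "Suc 0"] FactGroup_def)
qed

end

section \<open>2-cocycles as functionals that vanish on boundaries\<close>

locale lie_cocycle = lie_algebra scale br
  for scale :: "'k::field \<Rightarrow> 'v::ab_group_add \<Rightarrow> 'v" and br +
  fixes \<phi> :: "'v \<Rightarrow> 'v \<Rightarrow> 'k"
  assumes cocycle_linear_left: "\<phi> (scale a x + y) z = a * \<phi> x z + \<phi> y z"
    and cocycle_linear_right: "\<phi> z (scale a x + y) = a * \<phi> z x + \<phi> z y"
    and cocycle_self: "\<phi> x x = 0"
    and cocycle: "\<phi> (br x y) z + \<phi> (br y z) x + \<phi> (br z x) y = 0"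
begin

text \<open>Reading two entries from lists of every length makes this linear on the whole space of
  chains; the values outside length 2 carry no meaning.\<close>

definition cochain :: "('v list \<Rightarrow>\<^sub>0 'k) \<Rightarrow> 'k" where
  "cochain u = (\<Sum>xs\<in>Poly_Mapping.keys u. Poly_Mapping.lookup u xs * \<phi> (xs ! 0) (xs ! 1))"

sublocale cochain: Vector_Spaces.linear chain_scale "(*)" cochain
  unfolding cochain_def[abs_def] by (rule vector_space_over_itself.linear_poly_mapping_extension)

lemma cochain_single: "cochain (Poly_Mapping.single xs 1) = \<phi> (xs ! 0) (xs ! 1)"
  by (simp add: cochain_def)

lemma cochain_ext_relations_2:
  assumes "u \<in> ext_relations 2"
  shows "cochain u = 0"
proof -
  have "ext_relations 2 \<subseteq> {u. cochain u = 0}"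
  proof (rule ext_relations_2_subset[OF cochain.subspace_kernel], unfold mem_Collect_eq, goal_cases)
    case (1 a x y w)
    show ?case
      by (simp only: cochain.diff cochain.scale cochain_single nth_Cons_0 nth_Cons_Suc One_nat_def
        cocycle_linear_left add_diff_cancel_left' diff_self)
  next
    case (2 a x y w)
    show ?case
      by (simp only: cochain.diff cochain.scale cochain_single nth_Cons_0 nth_Cons_Suc One_nat_def
        cocycle_linear_right add_diff_cancel_left' diff_self)
  next
    case (3 x)
    show ?case
      by (simp only: cochain_single nth_Cons_0 nth_Cons_Suc One_nat_def cocycle_self)
  qed
  then show ?thesis
    using assms by blast
qed

lemma cocycle_neg_left: "\<phi> (- x) y = - \<phi> x y"
proof -
  have "\<phi> 0 y = \<phi> 0 y + \<phi> 0 y"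
    using cocycle_linear_left[of 1 0 0 y] by (simp only: scale_one mult_1 add_0_left)
  then have "\<phi> 0 y = 0"
    by (simp only: add_cancel_right_right)
  then have "\<phi> x y + \<phi> (- x) y = 0"
    using cocycle_linear_left[of 1 x "- x" y] by (simp only: scale_one mult_1 right_minus)
  then show ?thesis
    by (rule minus_unique[symmetric])
qed

text \<open>On a triple this is the cocycle identity, with \<open>br z x\<close> replaced by
  \<open>- br x z\<close> to match the order of entries in the boundary formula.\<close>

lemma cochain_ce_chain:
  assumes "u \<in> carrier (list_chains 3)"
  shows "cochain (ce_chain u) = 0"
proof -
  have "cochain (ce_tuple xs) = 0" if len: "length xs = 3" for xs
  proof -
    obtain x y z where xs: "xs = [x, y, z]"
      using len by (auto simp: numeral_3_eq_3 length_Suc_conv)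
    have "\<phi> (br x z) y = \<phi> (br x y) z + \<phi> (br y z) x"
      using cocycle[of x y z] unfolding br_skew[of x z] cocycle_neg_left
      by (simp only: eq_neg_iff_add_eq_0[symmetric] minus_minus)
    then show ?thesis
      by (simp add: xs ce_tuple_3 cochain.diff cochain_single)
  qed
  moreover have "length xs = 3" if "xs \<in> Poly_Mapping.keys u" for xs
    using assms that by (auto simp: in_keys_iff)
  ultimately show ?thesis
    by (simp add: ce_chain_def cochain.sum cochain.scale)
qed

lemma cochain_ce_boundaries_2:
  assumes "A \<in> ce_boundaries 2" "u \<in> A"
  shows "cochain u = 0"
proof -
  obtain B v where B: "B \<in> carrier (ext_power 3)" "v \<in> B"
    and u: "u \<in> ext_relations 2 #>\<^bsub>list_chains 2\<^esub> ce_chain v"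
    using assms by (auto simp: ce_boundaries_def ce_boundary_def)
  have "v \<in> carrier (list_chains 3)"
  proof -
    interpret N: normal "ext_relations 3" "list_chains 3"
      by (rule ext_relations_normal)
    show ?thesis
      using B N.rcosets_carrier[OF N.is_group]
      by (auto simp: ext_power_def FactGroup_def simp del: list_chains_simps(1))
  qed
  then show ?thesis
    using u by (auto simp: mem_coset_iff cochain.add cochain_ext_relations_2 cochain_ce_chain)
qed

text \<open>The identity of \<open>ce_homology 2\<close> is the set \<open>ce_boundaries 2\<close>
  itself. If the class equals it, then adding the coset of \<open>u\<close> to the boundary of zero
  yields a boundary. This boundary contains \<open>u\<close>, whereas \<open>cochain\<close>
  vanishes on all representatives of boundaries.\<close>

theorem homology_class_2_neq_one:
  assumes "u \<in> carrier (list_chains 2)" "cochain u \<noteq> 0"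
  shows "homology_class 2 (ext_relations 2 #>\<^bsub>list_chains 2\<^esub> u) \<noteq> \<one>\<^bsub>ce_homology 2\<^esub>"
proof
  let ?A = "ext_relations 2 #>\<^bsub>list_chains 2\<^esub> u"
  let ?B = "ce_boundary 3 (ext_relations 3 #>\<^bsub>list_chains 3\<^esub> 0)"
  assume "homology_class 2 ?A = \<one>\<^bsub>ce_homology 2\<^esub>"
  then have eq: "(\<Union>B\<in>ce_boundaries 2. {B <#>\<^bsub>list_chains 2\<^esub> ?A}) = ce_boundaries 2"
    by (simp add: homology_class_def ce_homology_def FactGroup_def r_coset_def ext_power_def)
  have "?B \<in> ce_boundaries 2"
    using carrier_ext_powerI[of 0 3] by (simp add: ce_boundaries_def)
  then have bdry: "?B <#>\<^bsub>list_chains 2\<^esub> ?A \<in> ce_boundaries 2"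
    using eq by blast
  have "0 \<in> ?B"
    using zero_mem_ext_relations[of 2] zero_mem_ext_relations[of 3]
    by (force simp: ce_boundary_def mem_coset_iff ce_chain.zero)
  moreover have "u \<in> ?A"
    using zero_mem_ext_relations by (force simp: mem_coset_iff)
  ultimately have "u \<in> ?B <#>\<^bsub>list_chains 2\<^esub> ?A"
    by (force simp: set_mult_def)
  then show False
    using cochain_ce_boundaries_2[OF bdry] assms(2) by blast
qed

end

section \<open>The explicit cocycle and the nonzero class\<close>

definition current_cocycle :: "complex poly ^ lidx \<Rightarrow> complex poly ^ lidx \<Rightarrow> complex" where
  "current_cocycle x y =
    coeff (x $ e1) 1 * coeff (y $ Em1) 0 + coeff (x $ e0) 1 * coeff (y $ E0) 0
    + coeff (x $ em1) 1 * coeff (y $ E1) 0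
    - coeff (y $ e1) 1 * coeff (x $ Em1) 0 - coeff (y $ e0) 1 * coeff (x $ E0) 0
    - coeff (y $ em1) 1 * coeff (x $ E1) 0"

text \<open>The Leibniz rule at 0, since the linear coefficient is the derivative there.\<close>

lemma coeff_mult_1: "coeff (p * q) 1 = coeff p 0 * coeff q 1 + coeff p 1 * coeff q 0"
  by (simp add: coeff_mult)

interpretation current: lie_cocycle lpoly_scale lbracket current_cocycle
proof
  fix x y z :: "complex poly ^ lidx" and a :: complex
  show "current_cocycle (lpoly_scale a x + y) z
      = a * current_cocycle x z + current_cocycle y z"
    and "current_cocycle z (lpoly_scale a x + y)
      = a * current_cocycle z x + current_cocycle z y"
    and "current_cocycle x x = 0"
    by (simp_all add: current_cocycle_def lpoly_scale_def algebra_simps)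
  show "current_cocycle (lbracket x y) z + current_cocycle (lbracket y z) x
      + current_cocycle (lbracket z x) y = 0"
    by (simp only: current_cocycle_def lbracket_nth coeff_mult_1 coeff_mult_0 coeff_add coeff_diff)
      algebra
qed

theorem propositionA2:
  shows "carrier (lpoly.ce_homology 2) \<noteq> {\<one>\<^bsub>lpoly.ce_homology 2\<^esub>} \<and>
    (let e = axis e1 1; E = axis Em1 1; t = [:0, 1:];
         z = lpoly.wedge [ltensor e t, ltensor E 1]
               \<otimes>\<^bsub>lpoly.ext_power 2\<^esub> inv\<^bsub>lpoly.ext_power 2\<^esub> lpoly.wedge [ltensor e 1, ltensor E t]
     in z \<in> lpoly.ce_cycles 2 \<and> lpoly.homology_class 2 z \<noteq> \<one>\<^bsub>lpoly.ce_homology 2\<^esub>)"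
proof -
  define t :: "complex poly" where "t = [:0, 1:]"
  define e E :: "complex ^ lidx" where "e = axis e1 1" and "E = axis Em1 1"
  define u :: "(complex poly ^ lidx) list \<Rightarrow>\<^sub>0 complex" where
    "u = Poly_Mapping.single [ltensor e t, ltensor E 1] 1
      - Poly_Mapping.single [ltensor e 1, ltensor E t] 1"
  define z where "z = lpoly.ext_relations 2 #>\<^bsub>list_chains 2\<^esub> u"
  have u: "u \<in> carrier (list_chains 2)"
    by (auto simp: u_def lookup_minus lookup_single when_def)
  have z: "lpoly.wedge [ltensor e t, ltensor E 1]
      \<otimes>\<^bsub>lpoly.ext_power 2\<^esub> inv\<^bsub>lpoly.ext_power 2\<^esub> lpoly.wedge [ltensor e 1, ltensor E t] = z"
    unfolding z_def u_def by (rule lpoly.wedge_diff) auto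
  \<comment> \<open>Both tuples have the same bracket \<open>ltensor (lbracket e E) t\<close>, so
    their boundaries cancel already as chains.\<close>
  have "lpoly.ce_chain u = 0"
    by (simp add: u_def lpoly.ce_chain.diff lpoly.ce_chain_single lpoly.ce_tuple_2
      lbracket_ltensor)
  then have cycle: "z \<in> lpoly.ce_cycles 2"
    unfolding z_def by (rule lpoly.coset_mem_ce_cycles_2[OF u])
  \<comment> \<open>The first tuple contributes 1, the linear coefficient of \<open>t\<close> times
    the constant 1. The second contributes 0, since \<open>ltensor e 1\<close> has no linear
    term.\<close>
  have "current.cochain u = 1"
    by (simp add: u_def current.cochain.diff current.cochain_single current_cocycle_def
      ltensor_def e_def E_def t_def axis_def)
  then have nontrivial: "lpoly.homology_class 2 z \<noteq> \<one>\<^bsub>lpoly.ce_homology 2\<^esub>"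
    unfolding z_def by (intro current.homology_class_2_neq_one[OF u]) simp
  have "lpoly.homology_class 2 z \<in> carrier (lpoly.ce_homology 2)"
    using cycle
    by (auto simp: lpoly.homology_class_def lpoly.ce_homology_def FactGroup_def RCOSETS_def)
  then show ?thesis
    using cycle nontrivial z unfolding Let_def t_def e_def E_def by auto
qed

end
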